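(* For every $\varepsilon>0$ and every $\alpha<1$ there exist $\delta>0$ and $K>0$ such that the following holds. Let $G$ be a connected graph on vertex set $[n]$, let $R\sim G(n,\varepsilon/n)$ and $G^*=G\cup R$. Then asymptotically almost surely, for every set $S\subseteq[n]$ that induces a connected subgraph of $G^*$ and satisfies $K\log n\le |S|\le \alpha n$, we have $|\partial_{G^*}S|\ge \delta|S|$.
   Context: $G(n,p)$ denotes the binomial random graph on $[n]$ with each pair an edge independently with probability $p$; $G\cup R$ is the graph on $[n]$ with edge set the union of those of $G$ and $R$. For a graph $H$ and a vertex set $S$, $\partial_H S$ is the set of edges of $H$ with exactly one endpoint in $S$. Asymptotically almost surely means with probability tending to $1$ as $n\to\infty$, for an arbitrary sequence of such graphs $G=G_n$. *)

theory Defs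
  imports "HOL-Probability.Probability"
begin

text \<open>Simple graphs on vertex set [n] = {0..<n}, represented by their edge sets:
  an edge is a two-element set of vertices.\<close>

definition all_pairs :: "nat \<Rightarrow> nat set set" where
  "all_pairs n = {e. \<exists>i j. i < n \<and> j < n \<and> i \<noteq> j \<and> e = {i, j}}"

definition gnp :: "nat \<Rightarrow> real \<Rightarrow> nat set set pmf" where
  "gnp n p = map_pmf (\<lambda>f. {e \<in> all_pairs n. f e})
               (Pi_pmf (all_pairs n) False (\<lambda>_. bernoulli_pmf p))"

definition induces_connected :: "nat set set \<Rightarrow> nat set \<Rightarrow> bool" where
  "induces_connected E S \<longleftrightarrow>
     (\<forall>u\<in>S. \<forall>v\<in>S. (\<lambda>x y. x \<in> S \<and> y \<in> S \<and> {x, y} \<in> E)\<^sup>*\<^sup>* u v)"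

definition connected_graph :: "nat \<Rightarrow> nat set set \<Rightarrow> bool" where
  "connected_graph n E \<longleftrightarrow> E \<subseteq> all_pairs n \<and> induces_connected E {..<n}"

definition edge_boundary :: "nat set set \<Rightarrow> nat set \<Rightarrow> nat set set" where
  "edge_boundary E S = {e \<in> E. card (e \<inter> S) = 1}"

definition expansion_property ::
  "real \<Rightarrow> real \<Rightarrow> real \<Rightarrow> nat \<Rightarrow> nat set set \<Rightarrow> bool" where
  "expansion_property \<alpha> \<delta> K n E \<longleftrightarrow>
     (\<forall>S \<subseteq> {..<n}. induces_connected E S \<and> K * ln (real n) \<le> real (card S)
        \<and> real (card S) \<le> \<alpha> * real n
        \<longrightarrow> real (card (edge_boundary E S)) \<ge> \<delta> * real (card S))"

end

theory Submission
  imports Defs "HOL-Real_Asymp.Real_Asymp"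
begin

text \<open>Fix a set \<open>S\<close> with \<open>k\<close> vertices and fewer than \<open>\<delta>k\<close> boundary edges. As \<open>G\<close> is connected, every
  component of \<open>G[S]\<close> sends a \<open>G\<close>-edge out of \<open>S\<close>, so there are fewer than \<open>\<delta>k\<close> components, and they
  are joined to each other by \<open>R\<close>-edges, one for each component except the first. The union bound
  runs over a representative \<open>r\<close> of the first component, the set \<open>Z\<close> of the remaining ends of these
  \<open>R\<close>-edges, the set \<open>S\<close>, and the other ends of the \<open>R\<close>-edges.
  Given \<open>r\<close> and \<open>Z\<close>, there are at most \<open>(1 - t)\<^sup>-\<^sup>k t\<^sup>-\<^sup>\<delta>\<^sup>k\<close> choices of \<open>S\<close>, whatever the degrees in \<open>G\<close>, by a
  percolation argument; the other ends cost \<open>(kp)\<close> each, where \<open>p = \<epsilon>/n\<close>, and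
  the sum over \<open>Z\<close> costs at most \<open>t\<^sup>-\<^sup>\<delta>\<^sup>k (1 + kpt)\<^sup>n\<close>. All these factors are \<open>exp(\<eta>k)\<close> with \<open>\<eta>\<close> small when
  first \<open>t\<close> and then \<open>\<delta>\<close> is small, and are beaten by the probability that \<open>R\<close> has at most \<open>\<delta>k\<close> of the
  \<open>k(n - k)\<close> pairs leaving \<open>S\<close>. The factor \<open>n\<close> for the choice of \<open>r\<close> is absorbed by \<open>k \<ge> K log n\<close>.\<close>

section \<open>Components of an induced subgraph\<close>

text \<open>The edge-closed subsets of \<open>S\<close> are exactly the unions of components of
  \<open>E[S]\<close>.\<close>

definition edge_closed :: "'a set set \<Rightarrow> 'a set \<Rightarrow> 'a set \<Rightarrow> bool" where
  "edge_closed E S T \<longleftrightarrow> T \<subseteq> S \<and> (\<forall>u\<in>T. \<forall>w\<in>S. {u, w} \<in> E \<longrightarrow> w \<in> T)"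

text \<open>As edge-closed sets are unions of components, the condition on \<open>T\<close> means
  that \<open>Y\<close> meets every component of \<open>E[S]\<close>.\<close>

definition spanned_by :: "'a set set \<Rightarrow> 'a set \<Rightarrow> 'a set \<Rightarrow> bool" where
  "spanned_by E Y S \<longleftrightarrow> Y \<subseteq> S \<and> (\<forall>T. Y \<subseteq> T \<longrightarrow> edge_closed E S T \<longrightarrow> T = S)"

lemma edge_closedD: "edge_closed E S T \<Longrightarrow> u \<in> T \<Longrightarrow> w \<in> S \<Longrightarrow> {u, w} \<in> E \<Longrightarrow> w \<in> T"
  unfolding edge_closed_def by blast

lemma edge_closed_subset: "edge_closed E S T \<Longrightarrow> T \<subseteq> S"
  unfolding edge_closed_def by blast

lemma spanned_byD: "spanned_by E Y S \<Longrightarrow> Y \<subseteq> T \<Longrightarrow> edge_closed E S T \<Longrightarrow> T = S"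
  unfolding spanned_by_def by blast

text \<open>A path inside \<open>S\<close> that starts in \<open>T\<close> never leaves
  \<open>T\<close>.\<close>

lemma induces_connected_edge_closed:
  assumes "induces_connected E S" and "edge_closed E S T" and "T \<noteq> {}"
  shows "T = S"
proof
  show "T \<subseteq> S" using assms(2) by (rule edge_closed_subset)
  show "S \<subseteq> T"
  proof
    fix v assume v: "v \<in> S"
    obtain u where u: "u \<in> T" using assms(3) by blast
    then have "u \<in> S" using assms(2) edge_closed_subset by blast
    then have "(\<lambda>x y. x \<in> S \<and> y \<in> S \<and> {x, y} \<in> E)\<^sup>*\<^sup>* u v"
      using assms(1) v unfolding induces_connected_def by blast
    then show "v \<in> T"
      by induction (use u assms(2) edge_closedD in fast)+
  qed
qed

text \<open>The intersection \<open>C\<close> of all closed sets containing \<open>w\<close> works: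
  a set closed in \<open>C\<close> is closed in \<open>S\<close>, because \<open>C\<close> itself
  is, so by minimality it cannot be smaller than \<open>C\<close> if it contains
  \<open>w\<close>.\<close>

lemma component_exists:
  assumes "w \<in> S"
  obtains C where "w \<in> C" "edge_closed E S C" "spanned_by E {w} C"
proof -
  define C where "C = \<Inter>{T. w \<in> T \<and> edge_closed E S T}"
  have S: "edge_closed E S S" unfolding edge_closed_def by blast
  have w: "w \<in> C" unfolding C_def by blast
  have CS: "C \<subseteq> S" using S assms unfolding C_def by blast
  have cl: "edge_closed E S C"
    using CS unfolding edge_closed_def C_def by blast
  have "T = C" if "{w} \<subseteq> T" and T: "edge_closed E C T" for T
  proof -
    have "edge_closed E S T"
      using T cl unfolding edge_closed_def by blast
    then show ?thesis using that edge_closed_subset[OF T] unfolding C_def by blast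
  qed
  then have "spanned_by E {w} C" using w unfolding spanned_by_def by blast
  then show ?thesis using that w cl by blast
qed

text \<open>Edges are undirected, so removing the closed set \<open>U\<close> leaves a set closed in
  \<open>C\<close>. It still contains \<open>w\<close>, hence is all of \<open>C\<close>.\<close>

lemma component_disjoint:
  assumes U: "edge_closed E S U" and w: "w \<notin> U"
    and C: "edge_closed E S C" and sp: "spanned_by E {w} C"
  shows "C \<inter> U = {}"
proof -
  have "w \<in> C" using sp unfolding spanned_by_def by blast
  moreover have "edge_closed E C (C - U)"
    unfolding edge_closed_def
  proof (intro conjI ballI impI)
    fix u v assume "u \<in> C - U" "v \<in> C" "{u, v} \<in> E"
    then show "v \<in> C - U"
      using edge_closedD[OF U, of v u] edge_closed_subset[OF C] by (auto simp: insert_commute)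
  qed blast
  ultimately have "C - U = C" using w by (intro spanned_byD[OF sp]) auto
  then show ?thesis by blast
qed

lemma edge_closed_Un:
  "edge_closed E S U \<Longrightarrow> edge_closed E S C \<Longrightarrow> edge_closed E S (U \<union> C)"
  unfolding edge_closed_def by blast

lemma spanned_by_Un:
  assumes "spanned_by E Y U" "spanned_by E Y' C"
  shows "spanned_by E (Y \<union> Y') (U \<union> C)"
  unfolding spanned_by_def
proof (intro conjI allI impI)
  show "Y \<union> Y' \<subseteq> U \<union> C" using assms unfolding spanned_by_def by blast
next
  fix T assume YT: "Y \<union> Y' \<subseteq> T" and T: "edge_closed E (U \<union> C) T"
  have "edge_closed E U (T \<inter> U)" "edge_closed E C (T \<inter> C)"
    using T unfolding edge_closed_def by auto
  moreover have "Y \<subseteq> T \<inter> U" "Y' \<subseteq> T \<inter> C"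
    using assms YT unfolding spanned_by_def by auto
  ultimately have "T \<inter> U = U" "T \<inter> C = C"
    using assms spanned_byD by metis+
  then show "T = U \<union> C" using edge_closed_subset[OF T] by blast
qed

text \<open>Here the connectivity of \<open>G\<close> enters: some \<open>G\<close>-edge leaves the
  proper nonempty subset \<open>C\<close> of the vertex set, and it cannot end in \<open>S\<close>
  since \<open>C\<close> is closed there.\<close>

lemma component_boundary_edge:
  assumes G: "connected_graph n G" and S: "S \<subset> {..<n}"
    and C: "edge_closed G S C" "C \<noteq> {}"
  obtains u w where "u \<in> C" "w \<notin> S" "{u, w} \<in> edge_boundary G S"
proof -
  have "C \<subset> {..<n}" using edge_closed_subset[OF C(1)] S by blast
  then have "\<not> edge_closed G {..<n} C"
    using induces_connected_edge_closed[of G "{..<n}" C] G C(2)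
    unfolding connected_graph_def by blast
  then obtain u w where uw: "u \<in> C" "w \<notin> C" "{u, w} \<in> G"
    using \<open>C \<subset> {..<n}\<close> unfolding edge_closed_def by blast
  then have w: "w \<notin> S" using C(1) edge_closedD by metis
  moreover have "u \<in> S" using uw(1) edge_closed_subset[OF C(1)] by blast
  ultimately have "{u, w} \<inter> S = {u}" by auto
  then have "{u, w} \<in> edge_boundary G S" using uw unfolding edge_boundary_def by simp
  then show ?thesis using that uw w by blast
qed

section \<open>Joining the components of \<open>G[S]\<close> by edges of \<open>R\<close>\<close>

lemma finite_all_pairs: "finite (all_pairs n)"
proof (rule finite_subset)
  show "all_pairs n \<subseteq> Pow {..<n}" unfolding all_pairs_def by auto
qed simp

text \<open>\<open>U\<close> is a union of components of \<open>G[S]\<close> that are joined to each other by \<open>R\<close>-edges: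
  \<open>r\<close> and the elements of \<open>Z\<close> represent the components, and \<open>x y\<close> is the end in an earlier
  component of the \<open>R\<close>-edge through which the component of \<open>y\<close> is attached.\<close>

definition attached ::
  "nat set set \<Rightarrow> nat set set \<Rightarrow> nat set \<Rightarrow> nat \<Rightarrow> nat set \<Rightarrow> (nat \<Rightarrow> nat) \<Rightarrow> nat set \<Rightarrow> bool" where
  "attached G R S r Z x U \<longleftrightarrow>
     edge_closed G S U \<and> spanned_by G (insert r Z) U \<and>
     (\<forall>y\<in>Z. x y \<in> U \<and> x y \<noteq> y \<and> {y, x y} \<in> R) \<and>
     inj_on (\<lambda>y. {y, x y}) Z \<and> finite Z \<and>
     card Z < card {e \<in> edge_boundary G S. e \<inter> U \<noteq> {}}"

text \<open>Connectivity of \<open>G \<union> R\<close> on \<open>S\<close> gives an edge from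
  \<open>U\<close> to some \<open>w\<close> in \<open>S - U\<close>, which must lie in
  \<open>R\<close> because \<open>U\<close> is closed in \<open>G\<close>. The component
  \<open>C\<close> of \<open>w\<close> is added to \<open>U\<close>. It brings a boundary edge that
  misses \<open>U\<close>, so the edge count grows at least as much as
  \<open>card Z\<close>.\<close>

lemma attached_step:
  assumes G: "connected_graph n G" and S: "S \<subset> {..<n}"
    and conn: "induces_connected (G \<union> R) S"
    and att: "attached G R S r Z x U" and ne: "U \<noteq> S"
  obtains Z' x' U' where "attached G R S r Z' x' U'" "U \<subset> U'"
proof -
  have U: "edge_closed G S U" and sp: "spanned_by G (insert r Z) U"
    and x: "\<And>y. y \<in> Z \<Longrightarrow> x y \<in> U \<and> x y \<noteq> y \<and> {y, x y} \<in> R"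
    and inj: "inj_on (\<lambda>y. {y, x y}) Z" and "finite Z"
    and crd: "card Z < card {e \<in> edge_boundary G S. e \<inter> U \<noteq> {}}"
    using att unfolding attached_def by auto
  have rZ: "r \<in> U" "Z \<subseteq> U" using sp unfolding spanned_by_def by auto
  have "\<not> edge_closed (G \<union> R) S U"
    using induces_connected_edge_closed[OF conn] ne rZ by blast
  then obtain u w where uw: "u \<in> U" "w \<in> S" "w \<notin> U" "{u, w} \<in> G \<union> R"
    using edge_closed_subset[OF U] unfolding edge_closed_def by blast
  have R: "{u, w} \<in> R" using edge_closedD[OF U uw(1,2)] uw by blast
  obtain C where C: "w \<in> C" "edge_closed G S C" "spanned_by G {w} C"
    using component_exists[OF uw(2)] by blast
  have disj: "C \<inter> U = {}" using component_disjoint[OF U uw(3) C(2,3)] .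
  obtain a b where ab: "a \<in> C" "b \<notin> S" "{a, b} \<in> edge_boundary G S"
    using component_boundary_edge[OF G S C(2)] C(1) by blast
  have fin: "finite (edge_boundary G S)"
    using G finite_subset[OF _ finite_all_pairs]
    unfolding connected_graph_def edge_boundary_def by auto
  have abU: "{a, b} \<inter> U = {}" using ab disj edge_closed_subset[OF U] by auto
  have "insert {a, b} {e \<in> edge_boundary G S. e \<inter> U \<noteq> {}}
        \<subseteq> {e \<in> edge_boundary G S. e \<inter> (U \<union> C) \<noteq> {}}"
    using ab by auto
  then have "card (insert {a, b} {e \<in> edge_boundary G S. e \<inter> U \<noteq> {}})
        \<le> card {e \<in> edge_boundary G S. e \<inter> (U \<union> C) \<noteq> {}}"
    using fin by (intro card_mono) auto
  then have crd': "Suc (card {e \<in> edge_boundary G S. e \<inter> U \<noteq> {}})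
        \<le> card {e \<in> edge_boundary G S. e \<inter> (U \<union> C) \<noteq> {}}"
    using fin abU by (subst (asm) card_insert_disjoint) auto
  have wZ: "w \<notin> Z" using rZ uw by blast
  have eq: "y \<in> Z \<Longrightarrow> (x(w := u)) y = x y" for y using wZ by auto
  \<comment> \<open>The new edge contains \<open>w\<close>, whereas all earlier attaching edges lie
    inside \<open>U\<close>.\<close>
  have "inj_on (\<lambda>y. {y, (x(w := u)) y}) (insert w Z)"
    unfolding inj_on_insert
  proof
    show "inj_on (\<lambda>y. {y, (x(w := u)) y}) Z"
      using inj eq by (simp cong: inj_on_cong)
    have "w \<notin> {y, x y}" if "y \<in> Z" for y
      using x[OF that] uw(3) that rZ by auto
    then show "{w, (x(w := u)) w} \<notin> (\<lambda>y. {y, (x(w := u)) y}) ` (Z - {w})"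
      using eq by fastforce
  qed
  moreover have "spanned_by G (insert r (insert w Z)) (U \<union> C)"
    using spanned_by_Un[OF sp C(3)] by (simp add: insert_commute)
  moreover have "card (insert w Z) < card {e \<in> edge_boundary G S. e \<inter> (U \<union> C) \<noteq> {}}"
    using crd crd' wZ \<open>finite Z\<close> by simp
  ultimately have "attached G R S r (insert w Z) (x(w := u)) (U \<union> C)"
    unfolding attached_def using x uw R edge_closed_Un[OF U C(2)] \<open>finite Z\<close>
    by (auto simp: insert_commute)
  then show ?thesis using that[of "insert w Z" "x(w := u)" "U \<union> C"] C(1) uw(3) by blast
qed

text \<open>The process starts with the component of an arbitrary \<open>r\<close>, whose boundary
  edge makes the inequality strict while \<open>Z\<close> is empty. Each step enlarges
  \<open>U\<close>, so it ends at \<open>S\<close>.\<close>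

lemma attached_exists:
  assumes G: "connected_graph n G" and S: "S \<subset> {..<n}"
    and conn: "induces_connected (G \<union> R) S" and "S \<noteq> {}"
  obtains r Z x where "attached G R S r Z x S"
proof -
  obtain r where r: "r \<in> S" using \<open>S \<noteq> {}\<close> by blast
  obtain C where C: "r \<in> C" "edge_closed G S C" "spanned_by G {r} C"
    using component_exists[OF r] by blast
  obtain a b where ab: "a \<in> C" "b \<notin> S" "{a, b} \<in> edge_boundary G S"
    using component_boundary_edge[OF G S C(2)] C(1) by blast
  have fin: "finite (edge_boundary G S)"
    using G finite_subset[OF _ finite_all_pairs]
    unfolding connected_graph_def edge_boundary_def by auto
  have "{a, b} \<in> {e \<in> edge_boundary G S. e \<inter> C \<noteq> {}}" using ab by auto
  then have "0 < card {e \<in> edge_boundary G S. e \<inter> C \<noteq> {}}"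
    using fin by (subst card_gt_0_iff) auto
  then have start: "attached G R S r {} (\<lambda>_. r) C" unfolding attached_def using C by auto
  have "finite S" using S finite_subset by blast
  have "\<exists>Z x. attached G R S r Z x S" if "attached G R S r Z x U" for Z x U
    using that
  proof (induction "card (S - U)" arbitrary: Z x U rule: less_induct)
    case less
    show ?case
    proof (cases "U = S")
      case True
      then show ?thesis using less.prems by blast
    next
      case False
      obtain Z' x' U' where att: "attached G R S r Z' x' U'" and "U \<subset> U'"
        using attached_step[OF G S conn less.prems False] .
      moreover have "U' \<subseteq> S" using att edge_closed_subset unfolding attached_def by blast
      ultimately have "card (S - U') < card (S - U)"
        using \<open>finite S\<close> by (intro psubset_card_mono) auto
      then show ?thesis using less.hyps att by blast
    qed
  qed
  then show ?thesis using start that by blast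
qed

section \<open>Percolation count of sets with small outer boundary\<close>

definition outer_boundary :: "'a set set \<Rightarrow> 'a set \<Rightarrow> 'a set \<Rightarrow> 'a set" where
  "outer_boundary E V S = {w \<in> V - S. \<exists>u\<in>S. {u, w} \<in> E}"

text \<open>Mapping a boundary edge to its end outside \<open>S\<close> covers the outer
  boundary.\<close>

lemma card_outer_boundary_le:
  assumes "finite (edge_boundary E S)"
  shows "card (outer_boundary E V S) \<le> card (edge_boundary E S)"
proof (rule surj_card_le[OF assms])
  show "outer_boundary E V S \<subseteq> (\<lambda>e. the_elem (e - S)) ` edge_boundary E S"
  proof
    fix w assume "w \<in> outer_boundary E V S"
    then obtain u where u: "u \<in> S" "w \<notin> S" "{u, w} \<in> E"
      unfolding outer_boundary_def by blast
    then have "{u, w} \<inter> S = {u}" "{u, w} - S = {w}" by auto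
    then have "{u, w} \<in> edge_boundary E S" "the_elem ({u, w} - S) = w"
      using u unfolding edge_boundary_def by auto
    then show "w \<in> (\<lambda>e. the_elem (e - S)) ` edge_boundary E S" by force
  qed
qed

text \<open>The weights are those of site percolation with retention probability \<open>1 - t\<close>: the events
  that the cluster of \<open>Y\<close> equals \<open>S\<close> are disjoint and have probability
  \<open>(1 - t) ^ card S * t ^ card (outer_boundary E V S)\<close>.\<close>

lemma percolation_sum_le_1:
  fixes t :: real and V :: "'a set"
  assumes V: "finite V" and t: "0 \<le> t" "t \<le> 1"
    and SS: "\<And>S. S \<in> SS \<Longrightarrow> S \<subseteq> V \<and> spanned_by E Y S"
  shows "(\<Sum>S\<in>SS. (1 - t) ^ card S * t ^ card (outer_boundary E V S)) \<le> 1"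
proof -
  define N where "N = outer_boundary E V"
  \<comment> \<open>\<open>A\<close> stands for the set of retained vertices. The zeros in
    \<open>f\<close> and \<open>g\<close> make \<open>W S A\<close> the probability of
    \<open>A\<close> if \<open>S \<subseteq> A\<close> and \<open>A\<close> avoids
    \<open>N S\<close>, and 0 otherwise.\<close>
  define f where "f S v = (if v \<in> N S then 0 else 1 - t)" for S and v :: 'a
  define g where "g S v = (if v \<in> S then 0 else t)" for S and v :: 'a
  define W where "W S A = (\<Prod>v\<in>A. f S v) * (\<Prod>v\<in>V - A. g S v)" for S A
  have finSS: "finite SS" by (rule finite_subset[of _ "Pow V"]) (use SS V in auto)
  have eq: "(1 - t) ^ card S * t ^ card (N S) = (\<Sum>A\<in>Pow V. W S A)" if "S \<in> SS" for S
  proof -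
    have SV: "S \<subseteq> V" "N S \<subseteq> V - S" using SS that unfolding N_def outer_boundary_def by auto
    have fins: "finite S" "finite (N S)" using SV V by (auto intro: finite_subset)
    have "(\<Sum>A\<in>Pow V. W S A) = (\<Prod>v\<in>V. f S v + g S v)"
      unfolding W_def by (rule prod_add[OF V, symmetric])
    also have "\<dots> = (\<Prod>v\<in>V. (if v \<in> S then 1 - t else 1) * (if v \<in> N S then t else 1))"
      using SV by (intro prod.cong) (auto simp: f_def g_def)
    also have "\<dots> = (\<Prod>v\<in>V. if v \<in> S then 1 - t else 1) * (\<Prod>v\<in>V. if v \<in> N S then t else 1)"
      by (rule prod.distrib)
    also have "\<dots> = (1 - t) ^ card S * t ^ card (N S)"
    proof -
      have "V \<inter> S = S" "V \<inter> N S = N S" using SV by auto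
      then show ?thesis using V by (simp add: prod.If_cases)
    qed
    finally show ?thesis ..
  qed
  have zero: "W S A = 0" if prems: "A \<in> Pow V" "S \<in> SS" "\<not> (S \<subseteq> A \<and> N S \<inter> A = {})" for S A
  proof -
    have fin: "finite A" "finite (V - A)" using that V finite_subset by auto
    show ?thesis
    proof (cases "S \<subseteq> A")
      case True
      then obtain v where "v \<in> A" "v \<in> N S" using prems by blast
      then have "v \<in> A" "f S v = 0" by (auto simp: f_def)
      then have "(\<Prod>v\<in>A. f S v) = 0" using fin by (meson prod_zero)
      then show ?thesis by (simp add: W_def)
    next
      case False
      then obtain v where "v \<in> S" "v \<notin> A" by blast
      then have "v \<in> V - A" "g S v = 0" using prems SS by (auto simp: g_def)
      then have "(\<Prod>v\<in>V - A. g S v) = 0" using fin by (meson prod_zero)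
      then show ?thesis by (simp add: W_def)
    qed
  qed
  have le: "W S A \<le> (1 - t) ^ card A * t ^ card (V - A)" for S A
  proof -
    have "(\<Prod>v\<in>A. f S v) \<le> (\<Prod>v\<in>A. 1 - t)" "(\<Prod>v\<in>V - A. g S v) \<le> (\<Prod>v\<in>V - A. t)"
      using t by (intro prod_mono; simp add: f_def g_def)+
    then show ?thesis
      unfolding W_def using t by (auto intro!: mult_mono prod_nonneg simp: f_def g_def)
  qed
  \<comment> \<open>An edge from \<open>S \<inter> S'\<close> to \<open>S - S'\<close> would end in
    \<open>N S'\<close> and in \<open>A\<close>, so \<open>S \<inter> S'\<close> is closed in
    \<open>S\<close>; containing \<open>Y\<close>, it equals \<open>S\<close>. Used in both
    directions, this leaves at most one nonzero \<open>W S A\<close> for each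
    \<open>A\<close>.\<close>
  have sub: "S \<subseteq> S'" if "S \<in> SS" "S' \<in> SS" "S \<subseteq> A" "N S' \<inter> A = {}" for S S' A
  proof -
    have "edge_closed E S (S \<inter> S')"
      using that SS[of S] unfolding edge_closed_def N_def outer_boundary_def by blast
    moreover have "Y \<subseteq> S \<inter> S'" using that SS unfolding spanned_by_def by blast
    ultimately have "S \<inter> S' = S" using SS[OF that(1)] spanned_byD by blast
    then show ?thesis by blast
  qed
  have inner: "(\<Sum>S\<in>SS. W S A) \<le> (1 - t) ^ card A * t ^ card (V - A)" if "A \<in> Pow V" for A
  proof (cases "\<exists>S\<in>SS. S \<subseteq> A \<and> N S \<inter> A = {}")
    case True
    then obtain S where S: "S \<in> SS" "S \<subseteq> A" "N S \<inter> A = {}" by blast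
    have "W S' A = 0" if "S' \<in> SS - {S}" for S'
      using sub[of S S' A] sub[of S' S A] S that zero[OF \<open>A \<in> Pow V\<close>, of S'] by blast
    then have "(\<Sum>S\<in>SS. W S A) = W S A"
      using finSS S(1) by (simp add: sum.remove)
    then show ?thesis using le by simp
  next
    case False
    then have "(\<Sum>S\<in>SS. W S A) = 0" using zero[OF that] by (intro sum.neutral) blast
    then show ?thesis using t by simp
  qed
  have "(\<Sum>S\<in>SS. (1 - t) ^ card S * t ^ card (N S)) = (\<Sum>S\<in>SS. \<Sum>A\<in>Pow V. W S A)"
    using eq by simp
  also have "\<dots> = (\<Sum>A\<in>Pow V. \<Sum>S\<in>SS. W S A)" by (rule sum.swap)
  also have "\<dots> \<le> (\<Sum>A\<in>Pow V. (1 - t) ^ card A * t ^ card (V - A))"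
    using inner by (rule sum_mono)
  also have "\<dots> = (\<Prod>v\<in>V. (1 - t) + t)"
    unfolding prod_add[OF V] by simp
  also have "\<dots> = 1" by simp
  finally show ?thesis unfolding N_def .
qed

text \<open>This trades a constraint \<open>m \<le> b\<close> for a weight \<open>t ^ m\<close> at
  the price \<open>t powr (-b)\<close>. It serves both for the cut edges of \<open>R\<close> and for
  the size of \<open>Z\<close>.\<close>

lemma one_le_power_mult_powr:
  fixes t b :: real
  assumes "0 < t" "t \<le> 1" "real m \<le> b"
  shows "1 \<le> t ^ m * t powr (-b)"
proof -
  have "t ^ m * t powr (-b) = t powr (real m - b)"
    using assms by (simp add: powr_realpow[symmetric] powr_add[symmetric])
  moreover have "t powr 0 \<le> t powr (real m - b)"
    using assms by (intro powr_mono') auto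
  ultimately show ?thesis using assms by simp
qed

text \<open>Each such set has percolation weight at least \<open>(1 - t) ^ k * t powr b\<close>, and
  the weights sum to at most 1.\<close>

lemma card_spanned_le:
  fixes t b :: real
  assumes V: "finite V" and t: "0 < t" "t < 1"
    and SS: "\<And>S. S \<in> SS \<Longrightarrow> S \<subseteq> V \<and> spanned_by E Y S \<and> card S = k \<and>
                              real (card (outer_boundary E V S)) \<le> b"
  shows "real (card SS) \<le> t powr (-b) / (1 - t) ^ k"
proof -
  have "(1 - t) ^ k * t powr b * real (card SS) = (\<Sum>S\<in>SS. (1 - t) ^ k * t powr b)"
    by simp
  also have "\<dots> \<le> (\<Sum>S\<in>SS. (1 - t) ^ card S * t ^ card (outer_boundary E V S))"
  proof (rule sum_mono)
    fix S assume "S \<in> SS"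
    with SS have S: "card S = k" "real (card (outer_boundary E V S)) \<le> b" by auto
    have "t powr b \<le> t powr real (card (outer_boundary E V S))"
      using t S by (intro powr_mono') auto
    then show "(1 - t) ^ k * t powr b \<le> (1 - t) ^ card S * t ^ card (outer_boundary E V S)"
      using t S by (simp add: powr_realpow)
  qed
  also have "\<dots> \<le> 1" using t SS by (intro percolation_sum_le_1[OF V]) auto
  finally show ?thesis
    using t by (simp add: field_simps powr_minus)
qed

section \<open>Probability estimate for a fixed vertex set\<close>

lemma card_edge_boundary_all_pairs:
  assumes S: "S \<subseteq> {..<n}"
  shows "card (edge_boundary (all_pairs n) S) = card S * (n - card S)"
proof -
  have fS: "finite S" using S finite_subset by blast
  have "bij_betw (\<lambda>(u, w). {u, w}) (S \<times> ({..<n} - S)) (edge_boundary (all_pairs n) S)"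
    unfolding bij_betw_def
  proof
    show "inj_on (\<lambda>(u, w). {u, w}) (S \<times> ({..<n} - S))"
      by (auto simp: inj_on_def doubleton_eq_iff)
    show "(\<lambda>(u, w). {u, w}) ` (S \<times> ({..<n} - S)) = edge_boundary (all_pairs n) S"
    proof (intro equalityI subsetI)
      fix e assume "e \<in> (\<lambda>(u, w). {u, w}) ` (S \<times> ({..<n} - S))"
      then obtain u w where e: "e = {u, w}" "u \<in> S" "w \<in> {..<n}" "w \<notin> S" by auto
      then have "e \<inter> S = {u}" by auto
      then show "e \<in> edge_boundary (all_pairs n) S"
        using e S unfolding edge_boundary_def all_pairs_def by fastforce
    next
      fix e assume "e \<in> edge_boundary (all_pairs n) S"
      then obtain i j where e: "e = {i, j}" "i < n" "j < n" "i \<noteq> j" "card (e \<inter> S) = 1"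
        unfolding edge_boundary_def all_pairs_def by auto
      have "\<not> (i \<in> S \<and> j \<in> S)"
      proof
        assume "i \<in> S \<and> j \<in> S"
        then have "e \<inter> S = {i, j}" using e by auto
        then show False using e by simp
      qed
      moreover have "i \<in> S \<or> j \<in> S" using e by (auto simp: Int_insert_left split: if_splits)
      ultimately show "e \<in> (\<lambda>(u, w). {u, w}) ` (S \<times> ({..<n} - S))"
        using e by (auto simp: image_iff insert_commute)
    qed
  qed
  then have "card (edge_boundary (all_pairs n) S) = card (S \<times> ({..<n} - S))"
    by (simp add: bij_betw_same_card)
  then show ?thesis using S fS by (simp add: card_cartesian_product card_Diff_subset)
qed

text \<open>An exponential Markov bound: the event is dominated by the indicator of
  \<open>F \<subseteq> R\<close> times \<open>t\<close> to the number of cut edges, rescaled by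
  \<open>t powr (-b)\<close>. The pairs in \<open>F\<close> lie inside \<open>S\<close>, so they are
  disjoint from the pairs leaving \<open>S\<close>, and the expectation factorizes by
  independence.\<close>

lemma gnp_containment_cut_prob_le:
  fixes p t b :: real
  assumes p: "0 \<le> p" "p \<le> 1" and t: "0 < t" "t \<le> 1"
    and S: "S \<subseteq> {..<n}" and F: "F \<subseteq> all_pairs n" "\<And>e. e \<in> F \<Longrightarrow> e \<subseteq> S"
  shows "measure_pmf.prob (gnp n p) {R. F \<subseteq> R \<and> real (card (edge_boundary R S)) \<le> b}
           \<le> p ^ card F * (t powr (-b) * (1 - p * (1 - t)) ^ (card S * (n - card S)))"
proof -
  define P where "P = all_pairs n"
  define B where "B = edge_boundary P S"
  have finP: "finite P" unfolding P_def by (rule finite_all_pairs)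
  have BP: "B \<subseteq> P" unfolding B_def edge_boundary_def by auto
  have FP: "F \<subseteq> P" using F P_def by simp
  have FB: "F \<inter> B = {}"
  proof -
    have "card (e \<inter> S) = 2" if "e \<in> F" for e
    proof -
      have "e \<inter> S = e" "e \<in> all_pairs n" using F that by auto
      then show ?thesis unfolding all_pairs_def by auto
    qed
    then show ?thesis unfolding B_def edge_boundary_def by fastforce
  qed
  \<comment> \<open>The factor contributed by one pair: containment for pairs of \<open>F\<close>,
    and \<open>t\<close> for each crossing pair that is present.\<close>
  define g where "g e c = (if e \<in> F then of_bool c else if e \<in> B \<and> c then t else 1 :: real)"
    for e c
  define q where "q = Pi_pmf P False (\<lambda>_. bernoulli_pmf p)"
  define A where "A = {R. F \<subseteq> R \<and> real (card (edge_boundary R S)) \<le> b}"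
  define h where "h f = {e \<in> P. f e}" for f
  have g0: "0 \<le> g e c" and g1: "g e c \<le> 1" for e c using t by (auto simp: g_def)
  have pt: "indicator A (h f) \<le> t powr (-b) * (\<Prod>e\<in>P. g e (f e))" for f
  proof (cases "h f \<in> A")
    case True
    define D where "D = edge_boundary (h f) S"
    have D: "D = {e \<in> B. f e}" unfolding D_def h_def B_def edge_boundary_def by auto
    have Fh: "F \<subseteq> h f" and cD: "real (card D) \<le> b" using True unfolding A_def D_def by auto
    have "(\<Prod>e\<in>P. g e (f e)) = (\<Prod>e\<in>P. if e \<in> D then t else 1)"
      using Fh FB by (intro prod.cong) (auto simp: g_def D h_def)
    also have "\<dots> = t ^ card D"
    proof -
      have "P \<inter> D = D" using BP D by auto
      then show ?thesis using finP by (simp add: prod.If_cases)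
    qed
    finally show ?thesis
      using one_le_power_mult_powr[OF t cD] True by (simp add: mult.commute)
  next
    case False
    then show ?thesis using g0 by (auto intro!: mult_nonneg_nonneg prod_nonneg)
  qed
  have "measure_pmf.prob (gnp n p) A = measure_pmf.prob q (h -` A)"
    unfolding gnp_def q_def h_def P_def by (simp add: measure_map_pmf)
  also have "\<dots> = measure_pmf.expectation q (\<lambda>f. indicator A (h f))"
    by (simp add: indicator_vimage[symmetric] comp_def)
  also have "\<dots> \<le> measure_pmf.expectation q (\<lambda>f. t powr (-b) * (\<Prod>e\<in>P. g e (f e)))"
  proof (rule integral_mono)
    show "integrable (measure_pmf q) (\<lambda>f. indicator A (h f) :: real)"
      by (rule measure_pmf.integrable_const_bound[where B = 1]) (auto simp: indicator_def)
    have "norm (\<Prod>e\<in>P. g e (f e)) \<le> 1" for f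
      using g0 g1 by (auto simp: abs_prod intro!: prod_le_1)
    then have "integrable (measure_pmf q) (\<lambda>f. \<Prod>e\<in>P. g e (f e))"
      by (intro measure_pmf.integrable_const_bound[where B = 1]) auto
    then show "integrable (measure_pmf q) (\<lambda>f. t powr (-b) * (\<Prod>e\<in>P. g e (f e)))"
      by simp
  qed (rule pt)
  also have "\<dots> = t powr (-b) * measure_pmf.expectation q (\<lambda>f. \<Prod>e\<in>P. g e (f e))"
    by simp
  also have "measure_pmf.expectation q (\<lambda>f. \<Prod>e\<in>P. g e (f e))
             = (\<Prod>e\<in>P. measure_pmf.expectation (bernoulli_pmf p) (g e))"
    unfolding q_def
    by (rule expectation_prod_Pi_pmf[OF finP]) (auto intro!: integrable_measure_pmf_finite simp: g0)
  also have "\<dots> = (\<Prod>e\<in>P. (if e \<in> F then p else 1) * (if e \<in> B then 1 - p * (1 - t) else 1))"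
    using p FB by (intro prod.cong) (auto simp: g_def algebra_simps)
  also have "\<dots> = p ^ card F * (1 - p * (1 - t)) ^ card B"
  proof -
    have "P \<inter> F = F" "P \<inter> B = B" using FP BP by auto
    then show ?thesis using finP by (simp add: prod.distrib prod.If_cases)
  qed
  also have "card B = card S * (n - card S)"
    unfolding B_def P_def by (rule card_edge_boundary_all_pairs[OF S])
  finally show ?thesis unfolding A_def by (simp add: mult_ac)
qed

section \<open>Union bound over the attachment structures\<close>

text \<open>The union runs over \<open>r\<close>, \<open>Z\<close>, \<open>S\<close> and the
  attaching map \<open>x\<close>. Of the three factors \<open>t powr (-b)\<close>, one counts the
  sets \<open>S\<close>, one comes from the cut probability, and one pays for giving each element of
  \<open>Z\<close> a weight \<open>t\<close>.\<close>

lemma expansion_failure_prob_le: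
  fixes p t b :: real
  assumes G: "connected_graph n G" and k: "0 < k" "k < n"
    and p: "0 \<le> p" "p \<le> 1" and t: "0 < t" "t < 1"
  shows "measure_pmf.prob (gnp n p) {R. R \<subseteq> all_pairs n \<and>
            (\<exists>S\<subseteq>{..<n}. induces_connected (G \<union> R) S \<and> card S = k \<and>
                       real (card (edge_boundary (G \<union> R) S)) \<le> b)}
         \<le> real n * (1 + real k * p * t) ^ n * (t powr (-b)) ^ 3 / (1 - t) ^ k
             * (1 - p * (1 - t)) ^ (k * (n - k))"
    (is "measure_pmf.prob _ ?B \<le> _")
proof -
  define V where "V = {..<n}"
  define M where "M = t powr (-b)"
  define D where "D = (1 - p * (1 - t)) ^ (k * (n - k))"
  define ZZ where "ZZ = {Z. Z \<subseteq> V \<and> real (card Z) \<le> b}"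
  define SS where "SS r Z = {S. S \<subseteq> V \<and> spanned_by G (insert r Z) S \<and> card S = k \<and>
      real (card (outer_boundary G V S)) \<le> b}" for r Z
  \<comment> \<open>Injectivity makes the attaching edges distinct, so that containing them all
    costs \<open>p ^ card Z\<close>; extensionality limits the maps to
    \<open>k ^ card Z\<close>.\<close>
  define X where "X Z S = {x \<in> Z \<rightarrow>\<^sub>E S. inj_on (\<lambda>y. {y, x y}) Z \<and> (\<forall>y\<in>Z. x y \<noteq> y)}"
    for Z S :: "nat set"
  define Ev where "Ev Z S x = {R. (\<lambda>y. {y, x y}) ` Z \<subseteq> R \<and> real (card (edge_boundary R S)) \<le> b}"
    for Z S :: "nat set" and x :: "nat \<Rightarrow> nat"
  let ?P = "measure_pmf.prob (gnp n p)"
  have M: "0 < M" using t unfolding M_def by simp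
  have p1: "0 \<le> 1 - p * (1 - t)"
    using p t mult_mono[of p 1 "1 - t" 1] by simp
  have D: "0 \<le> D" using p1 unfolding D_def by simp
  have finV: "finite V" unfolding V_def by simp
  have finZZ: "finite ZZ" unfolding ZZ_def using finV by simp
  have finZ: "finite Z" if "Z \<in> ZZ" for Z using that finV finite_subset unfolding ZZ_def by auto
  have finSS: "finite (SS r Z)" for r Z unfolding SS_def using finV by simp
  have cover: "?B \<subseteq> (\<Union>r\<in>V. \<Union>Z\<in>ZZ. \<Union>S\<in>SS r Z. \<Union>x\<in>X Z S. Ev Z S x)"
  proof
    fix R assume "R \<in> ?B"
    then obtain S where R: "R \<subseteq> all_pairs n" and SV: "S \<subseteq> {..<n}"
      and conn: "induces_connected (G \<union> R) S" and cS: "card S = k"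
      and bd: "real (card (edge_boundary (G \<union> R) S)) \<le> b" by blast
    have "S \<subset> {..<n}" "S \<noteq> {}" using SV cS k by auto
    then obtain r Z x where att: "attached G R S r Z x S"
      using attached_exists[OF G _ conn] by blast
    have fin: "finite (edge_boundary (G \<union> R) S)"
      using G R finite_subset[OF _ finite_all_pairs]
      unfolding connected_graph_def edge_boundary_def by auto
    have sub: "edge_boundary G S \<subseteq> edge_boundary (G \<union> R) S"
        "edge_boundary R S \<subseteq> edge_boundary (G \<union> R) S"
      unfolding edge_boundary_def by auto
    have finG: "finite (edge_boundary G S)" using fin sub finite_subset by blast
    have bG: "real (card (edge_boundary G S)) \<le> b" and bR: "real (card (edge_boundary R S)) \<le> b"
      using card_mono[OF fin sub(1)] card_mono[OF fin sub(2)] bd by linarith+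
    have sp: "spanned_by G (insert r Z) S"
      and x: "\<And>y. y \<in> Z \<Longrightarrow> x y \<in> S \<and> x y \<noteq> y \<and> {y, x y} \<in> R"
      and inj: "inj_on (\<lambda>y. {y, x y}) Z"
      and cZ: "card Z < card {e \<in> edge_boundary G S. e \<inter> S \<noteq> {}}"
      using att unfolding attached_def by auto
    have "card {e \<in> edge_boundary G S. e \<inter> S \<noteq> {}} \<le> card (edge_boundary G S)"
      using finG by (intro card_mono) auto
    then have "real (card Z) \<le> b" using cZ bG by linarith
    moreover have rZ: "r \<in> V" "Z \<subseteq> V" using sp SV unfolding spanned_by_def V_def by auto
    ultimately have Z: "Z \<in> ZZ" unfolding ZZ_def by simp
    have "real (card (outer_boundary G V S)) \<le> b"
      using card_outer_boundary_le[OF finG, of V] bG by linarith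
    then have S: "S \<in> SS r Z" using SV sp cS unfolding SS_def V_def by simp
    have X: "restrict x Z \<in> X Z S"
      using x inj unfolding X_def by (auto cong: inj_on_cong)
    have "R \<in> Ev Z S (restrict x Z)"
      using x bR unfolding Ev_def by auto
    then show "R \<in> (\<Union>r\<in>V. \<Union>Z\<in>ZZ. \<Union>S\<in>SS r Z. \<Union>x\<in>X Z S. Ev Z S x)"
      using rZ(1) Z S X by blast
  qed
  have "?P (Ev Z S x) \<le> p ^ card Z * (M * D)"
    if Z: "Z \<in> ZZ" and S: "S \<in> SS r Z" and x: "x \<in> X Z S" for r Z S x
  proof -
    have ZS: "Z \<subseteq> S" and SV: "S \<subseteq> {..<n}" and cS: "card S = k"
      using S unfolding SS_def spanned_by_def V_def by auto
    have xS: "\<And>y. y \<in> Z \<Longrightarrow> x y \<in> S \<and> x y \<noteq> y" and inj: "inj_on (\<lambda>y. {y, x y}) Z"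
      using x unfolding X_def by auto
    have "(\<lambda>y. {y, x y}) ` Z \<subseteq> all_pairs n"
    proof
      fix e assume "e \<in> (\<lambda>y. {y, x y}) ` Z"
      then obtain y where y: "y \<in> Z" "e = {y, x y}" by blast
      then have "y < n" "x y < n" "y \<noteq> x y" using xS[of y] ZS SV by auto
      then show "e \<in> all_pairs n" unfolding all_pairs_def y(2) by blast
    qed
    moreover have "e \<subseteq> S" if "e \<in> (\<lambda>y. {y, x y}) ` Z" for e using that xS ZS by auto
    ultimately show ?thesis
      using gnp_containment_cut_prob_le[OF p t(1) less_imp_le[OF t(2)] SV,
          of "(\<lambda>y. {y, x y}) ` Z" b]
      unfolding Ev_def M_def D_def cS by (simp add: card_image[OF inj])
  qed
  then have sumx: "?P (\<Union>x\<in>X Z S. Ev Z S x) \<le> (real k * p) ^ card Z * (M * D)"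
    if Z: "Z \<in> ZZ" and S: "S \<in> SS r Z" for r Z S
  proof -
    have "finite S" "card S = k" using S finV finite_subset unfolding SS_def by auto
    then have fin: "finite (Z \<rightarrow>\<^sub>E S)" and crd: "card (Z \<rightarrow>\<^sub>E S) = k ^ card Z"
      using finZ[OF Z] by (auto simp: finite_PiE card_funcsetE)
    have sub: "X Z S \<subseteq> Z \<rightarrow>\<^sub>E S" unfolding X_def by auto
    have "?P (\<Union>x\<in>X Z S. Ev Z S x) \<le> (\<Sum>x\<in>X Z S. ?P (Ev Z S x))"
      using finite_subset[OF sub fin] by (intro measure_UNION_le) auto
    also have "\<dots> \<le> real (card (X Z S)) * (p ^ card Z * (M * D))"
      using \<open>\<And>x S r Z. Z \<in> ZZ \<Longrightarrow> S \<in> SS r Z \<Longrightarrow> x \<in> X Z S \<Longrightarrow> ?P (Ev Z S x) \<le> p ^ card Z * (M * D)\<close>[OF Z S]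
      by (intro sum_bounded_above) auto
    also have "\<dots> \<le> real (k ^ card Z) * (p ^ card Z * (M * D))"
      using card_mono[OF fin sub] crd p M D by (intro mult_right_mono) auto
    finally show ?thesis by (simp add: power_mult_distrib)
  qed
  have sumS: "?P (\<Union>S\<in>SS r Z. \<Union>x\<in>X Z S. Ev Z S x)
      \<le> (real k * p * t) ^ card Z * (M ^ 3 / (1 - t) ^ k * D)"
    if Z: "Z \<in> ZZ" for r Z
  proof -
    have "?P (\<Union>S\<in>SS r Z. \<Union>x\<in>X Z S. Ev Z S x) \<le> (\<Sum>S\<in>SS r Z. ?P (\<Union>x\<in>X Z S. Ev Z S x))"
      using finSS by (intro measure_UNION_le) auto
    also have "\<dots> \<le> real (card (SS r Z)) * ((real k * p) ^ card Z * (M * D))"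
      using sumx[OF Z] by (intro sum_bounded_above) auto
    also have "\<dots> \<le> (M / (1 - t) ^ k) * ((real k * p) ^ card Z * (M * D))"
    proof (rule mult_right_mono)
      show "real (card (SS r Z)) \<le> M / (1 - t) ^ k"
        unfolding M_def by (rule card_spanned_le[OF finV t]) (auto simp: SS_def)
    qed (use p M D in auto)
    \<comment> \<open>Inserting \<open>t ^ card Z * M\<close>, which is at least 1, damps the sum
      over \<open>Z\<close>: it will give \<open>1 + real k * p * t\<close> instead of
      \<open>1 + real k * p\<close> per vertex.\<close>
    also have "\<dots> \<le> (M / (1 - t) ^ k) * (((t ^ card Z * M) * (real k * p) ^ card Z) * (M * D))"
    proof -
      have "1 \<le> t ^ card Z * M"
        using one_le_power_mult_powr[of t "card Z" b] t Z unfolding M_def ZZ_def by simp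
      then have "1 * (real k * p) ^ card Z \<le> (t ^ card Z * M) * (real k * p) ^ card Z"
        using p by (intro mult_right_mono) auto
      then show ?thesis using M D t by (intro mult_left_mono mult_right_mono) auto
    qed
    also have "\<dots> = (real k * p * t) ^ card Z * (M ^ 3 / (1 - t) ^ k * D)"
      by (simp add: power_mult_distrib power3_eq_cube)
    finally show ?thesis .
  qed
  have sumZ: "?P (\<Union>Z\<in>ZZ. \<Union>S\<in>SS r Z. \<Union>x\<in>X Z S. Ev Z S x)
      \<le> (1 + real k * p * t) ^ n * (M ^ 3 / (1 - t) ^ k * D)" for r
  proof -
    have "?P (\<Union>Z\<in>ZZ. \<Union>S\<in>SS r Z. \<Union>x\<in>X Z S. Ev Z S x)
        \<le> (\<Sum>Z\<in>ZZ. ?P (\<Union>S\<in>SS r Z. \<Union>x\<in>X Z S. Ev Z S x))"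
      using finZZ by (intro measure_UNION_le) auto
    also have "\<dots> \<le> (\<Sum>Z\<in>ZZ. (real k * p * t) ^ card Z * (M ^ 3 / (1 - t) ^ k * D))"
      using sumS by (rule sum_mono)
    also have "\<dots> = (\<Sum>Z\<in>ZZ. (real k * p * t) ^ card Z) * (M ^ 3 / (1 - t) ^ k * D)"
      by (rule sum_distrib_right[symmetric])
    \<comment> \<open>The size restriction on \<open>Z\<close> has been spent on the weight, so the
      sum may extend to all subsets and becomes a product.\<close>
    also have "\<dots> \<le> (\<Sum>Z\<in>Pow V. (real k * p * t) ^ card Z) * (M ^ 3 / (1 - t) ^ k * D)"
      using finV p t M D unfolding ZZ_def
      by (intro mult_right_mono sum_mono2) auto
    also have "(\<Sum>Z\<in>Pow V. (real k * p * t) ^ card Z) = (\<Prod>v\<in>V. real k * p * t + 1)"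
      unfolding prod_add[OF finV] by simp
    also have "\<dots> = (1 + real k * p * t) ^ n" by (simp add: V_def add.commute)
    finally show ?thesis .
  qed
  have "?P ?B \<le> ?P (\<Union>r\<in>V. \<Union>Z\<in>ZZ. \<Union>S\<in>SS r Z. \<Union>x\<in>X Z S. Ev Z S x)"
    using cover by (intro measure_pmf.finite_measure_mono) auto
  also have "\<dots> \<le> (\<Sum>r\<in>V. ?P (\<Union>Z\<in>ZZ. \<Union>S\<in>SS r Z. \<Union>x\<in>X Z S. Ev Z S x))"
    using finV by (intro measure_UNION_le) auto
  also have "\<dots> \<le> real (card V) * ((1 + real k * p * t) ^ n * (M ^ 3 / (1 - t) ^ k * D))"
    using sumZ by (intro sum_bounded_above) auto
  finally show ?thesis by (simp add: V_def M_def D_def mult_ac)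
qed

section \<open>Numerical estimates\<close>

lemma inverse_one_minus_le_exp:
  fixes t :: real
  assumes "0 \<le> t" "t \<le> 1/2"
  shows "1 / (1 - t) \<le> exp (2 * t)"
proof -
  have "1 \<le> (1 + 2 * t) * (1 - t)"
    using assms mult_nonneg_nonneg[of t "1 - 2 * t"] by (simp add: algebra_simps)
  also have "\<dots> \<le> exp (2 * t) * (1 - t)"
    using assms exp_ge_add_one_self[of "2 * t"] by (intro mult_right_mono) auto
  finally show ?thesis using assms by (simp add: field_simps)
qed

text \<open>Per unit of \<open>k\<close>, the exponents are \<open>\<epsilon> * t\<close> from the
  sum over \<open>Z\<close>, \<open>c / 4\<close> from the cubed factor, \<open>2 * t\<close> from
  \<open>1 / (1 - t) ^ k\<close>, and \<open>- c\<close> from the cut. Since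
  \<open>(\<epsilon> + 2) * t \<le> c / 2\<close>, they total at most
  \<open>- c / 4\<close>.\<close>

lemma failure_bound_exponential:
  fixes \<epsilon> \<alpha> t c b :: real
  assumes \<epsilon>: "0 < \<epsilon>" "\<epsilon> \<le> real n" and k: "0 < k" "real k \<le> \<alpha> * real n" and \<alpha>: "\<alpha> < 1"
    and t: "0 < t" "t \<le> 1/2" "(\<epsilon> + 2) * t \<le> c / 2" and c: "c = \<epsilon> * (1 - \<alpha>) / 2"
    and b: "b = c / (12 * - ln t) * real k"
  shows "real n * (1 + real k * (\<epsilon> / real n) * t) ^ n * (t powr (-b)) ^ 3 / (1 - t) ^ k
             * (1 - \<epsilon> / real n * (1 - t)) ^ (k * (n - k))
         \<le> real n * exp (- c / 4 * real k)"
proof -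
  have n: "0 < real n" using \<epsilon> by linarith
  have lnt: "ln t < 0" using t by simp
  have "(1 + real k * (\<epsilon> / real n) * t) ^ n \<le> exp (real k * (\<epsilon> / real n) * t) ^ n"
    using \<epsilon> t by (intro power_mono) auto
  also have "\<dots> = exp (\<epsilon> * t * real k)"
    using n by (simp add: exp_of_nat_mult[symmetric] mult_ac)
  finally have 1: "(1 + real k * (\<epsilon> / real n) * t) ^ n \<le> exp (\<epsilon> * t * real k)" .
  have "(t powr (-b)) ^ 3 = exp (real 3 * (-b * ln t))"
    using t by (simp only: powr_def exp_of_nat_mult) auto
  also have "real 3 * (-b * ln t) = c / 4 * real k"
    using lnt unfolding b by (simp add: field_simps)
  finally have 2: "(t powr (-b)) ^ 3 = exp (c / 4 * real k)" .
  have "1 / (1 - t) ^ k = (1 / (1 - t)) ^ k" by (simp add: power_divide)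
  also have "\<dots> \<le> exp (2 * t) ^ k"
    using t inverse_one_minus_le_exp[of t] by (intro power_mono) auto
  also have "\<dots> = exp (2 * t * real k)" by (simp add: exp_of_nat_mult[symmetric] mult_ac)
  finally have 3: "1 / (1 - t) ^ k \<le> exp (2 * t * real k)" .
  define s where "s = \<epsilon> / real n * (1 - t)"
  have s: "0 \<le> s" "s \<le> 1"
  proof -
    show "0 \<le> s" using \<epsilon> t n unfolding s_def by simp
    have "\<epsilon> / real n \<le> 1" using \<epsilon> n by simp
    then have "s \<le> 1 * 1" using \<epsilon> t n unfolding s_def by (intro mult_mono) auto
    then show "s \<le> 1" by simp
  qed
  have kn: "(1 - \<alpha>) * real n \<le> real n - real k" using k by (simp add: algebra_simps)
  have "0 < (1 - \<alpha>) * real n" using \<alpha> n by simp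
  then have "k < n" using kn by linarith
  have "(1 - s) ^ (k * (n - k)) \<le> exp (- s) ^ (k * (n - k))"
    using s exp_ge_add_one_self[of "-s"] by (intro power_mono) auto
  also have "\<dots> = exp (- (s * (real k * (real n - real k))))"
    using \<open>k < n\<close> by (simp add: exp_of_nat_mult[symmetric] of_nat_diff mult_ac)
  also have "\<dots> \<le> exp (- (c * real k))"
  proof -
    \<comment> \<open>The value of \<open>c\<close> comes from \<open>1 - t \<ge> 1/2\<close> and
      \<open>real n - real k \<ge> (1 - \<alpha>) * real n\<close>.\<close>
    have "c * real k = (\<epsilon> / real n * (1/2)) * (real k * ((1 - \<alpha>) * real n))"
      using n unfolding c by simp
    also have "\<dots> \<le> s * (real k * (real n - real k))"
      unfolding s_def using kn \<alpha> n t \<epsilon> by (intro mult_mono mult_left_mono) auto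
    finally show ?thesis by simp
  qed
  finally have 4: "(1 - s) ^ (k * (n - k)) \<le> exp (- (c * real k))" .
  have "(1 + real k * (\<epsilon> / real n) * t) ^ n * (t powr (-b)) ^ 3 * (1 / (1 - t) ^ k) * (1 - s) ^ (k * (n - k))
      \<le> exp (\<epsilon> * t * real k) * exp (c / 4 * real k) * exp (2 * t * real k) * exp (- (c * real k))"
    using 1 2 3 4 s t \<epsilon> by (intro mult_mono) auto
  also have "\<dots> = exp (((\<epsilon> + 2) * t + c / 4 - c) * real k)"
    by (simp add: exp_add[symmetric] algebra_simps)
  also have "\<dots> \<le> exp (- c / 4 * real k)"
  proof -
    have "(\<epsilon> + 2) * t + c / 4 - c \<le> - c / 4" using t(3) by simp
    then show ?thesis unfolding exp_le_cancel_iff by (intro mult_right_mono) auto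
  qed
  finally have "real n * ((1 + real k * (\<epsilon> / real n) * t) ^ n * (t powr (-b)) ^ 3
      * (1 / (1 - t) ^ k) * (1 - s) ^ (k * (n - k))) \<le> real n * exp (- c / 4 * real k)"
    by (rule mult_left_mono) simp
  then show ?thesis unfolding s_def by (simp add: mult.assoc)
qed

section \<open>Choice of constants and passage to the limit\<close>

theorem theorem3:
  fixes \<epsilon> \<alpha> :: real
  assumes "\<epsilon> > 0" and "\<alpha> < 1"
  shows "\<exists>\<delta>>0. \<exists>K>0. \<forall>G :: nat \<Rightarrow> nat set set.
           (\<forall>n. connected_graph n (G n)) \<longrightarrow>
           ((\<lambda>n. measure_pmf.prob (gnp n (\<epsilon> / real n))
                   {R. expansion_property \<alpha> \<delta> K n (G n \<union> R)}) \<longlonglongrightarrow> 1)"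
proof -
  define c where "c = \<epsilon> * (1 - \<alpha>) / 2"
  \<comment> \<open>\<open>t\<close> is chosen so that
    \<open>(\<epsilon> + 2) * t \<le> c / 2\<close>. The 12 in \<open>\<delta>\<close> is 3 times 4:
    the cube of \<open>t powr (-(\<delta> * k))\<close> is then
    \<open>exp (c / 4 * k)\<close>.\<close>
  define t where "t = min (1/2) (c / (2 * (\<epsilon> + 2)))"
  define \<delta> where "\<delta> = c / (12 * - ln t)"
  \<comment> \<open>With this \<open>K\<close>, \<open>exp (- c / 4 * k)\<close> is at most
    \<open>n\<close> to the power -3. After the factor \<open>n\<close> for the choice of
    \<open>r\<close> and at most \<open>n\<close> values of \<open>k\<close>, a failure probability
    of \<open>1 / n\<close> remains.\<close>
  define K where "K = 12 / c"
  have c: "0 < c" using assms unfolding c_def by simp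
  have t: "0 < t" "t \<le> 1/2" using c assms unfolding t_def by (simp, linarith)
  have "t \<le> c / (2 * (\<epsilon> + 2))" unfolding t_def by simp
  then have tc: "(\<epsilon> + 2) * t \<le> c / 2" using assms by (simp add: field_simps)
  have "ln t < 0" using t by simp
  then have \<delta>: "0 < \<delta>" using c unfolding \<delta>_def by (simp add: divide_pos_neg)
  have K: "0 < K" using c unfolding K_def by simp
  have "(\<lambda>n. measure_pmf.prob (gnp n (\<epsilon> / real n))
            {R. expansion_property \<alpha> \<delta> K n (G n \<union> R)}) \<longlonglongrightarrow> 1"
    if G: "\<And>n. connected_graph n (G n)" for G
  proof (rule tendsto_sandwich)
    let ?P = "\<lambda>n. measure_pmf.prob (gnp n (\<epsilon> / real n))"
    let ?E = "\<lambda>n. {R. expansion_property \<alpha> \<delta> K n (G n \<union> R)}"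
    show "(\<lambda>n. 1 - 1 / real n) \<longlonglongrightarrow> 1" by real_asymp
    show "\<forall>\<^sub>F n in sequentially. ?P n (?E n) \<le> 1" by simp
    show "\<forall>\<^sub>F n in sequentially. 1 - 1 / real n \<le> ?P n (?E n)"
      \<comment> \<open>\<open>n \<ge> 2\<close> makes \<open>ln n\<close> positive, which excludes
        the empty set, and \<open>n \<ge> \<epsilon>\<close> makes \<open>\<epsilon> / n\<close> a
        probability.\<close>
      using eventually_ge_at_top[of "max 2 (nat \<lceil>\<epsilon>\<rceil>)"]
    proof eventually_elim
      case (elim n)
      then have n: "2 \<le> n" "\<epsilon> \<le> real n" by auto
      define B where "B k = {R. R \<subseteq> all_pairs n \<and>
            (\<exists>S\<subseteq>{..<n}. induces_connected (G n \<union> R) S \<and> card S = k \<and>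
                       real (card (edge_boundary (G n \<union> R) S)) \<le> \<delta> * real k)}" for k
      define I where "I = {k \<in> {1..n}. K * ln (real n) \<le> real k \<and> real k \<le> \<alpha> * real n}"
      have lnn: "0 < ln (real n)" using n by simp
      \<comment> \<open>The support supplies \<open>R \<subseteq> all_pairs n\<close>, which
        \<open>B\<close> demands so that boundaries are finite and \<open>card\<close> is a genuine
        count.\<close>
      have sub: "- ?E n \<inter> set_pmf (gnp n (\<epsilon> / real n)) \<subseteq> (\<Union>k\<in>I. B k)"
      proof
        fix R assume R: "R \<in> - ?E n \<inter> set_pmf (gnp n (\<epsilon> / real n))"
        then obtain S where S: "S \<subseteq> {..<n}" "induces_connected (G n \<union> R) S"
          "K * ln (real n) \<le> real (card S)" "real (card S) \<le> \<alpha> * real n"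
          "real (card (edge_boundary (G n \<union> R) S)) < \<delta> * real (card S)"
          unfolding expansion_property_def Compl_iff Int_iff mem_Collect_eq not_le[symmetric]
          by blast
        have "0 < real (card S)" using mult_pos_pos[OF K lnn] S(3) by linarith
        moreover have "card S \<le> n" using card_mono[OF _ S(1)] by simp
        ultimately have "card S \<in> I" using S unfolding I_def by auto
        moreover have "R \<subseteq> all_pairs n" using R unfolding gnp_def by auto
        then have "R \<in> B (card S)" using S less_imp_le[OF S(5)] unfolding B_def by blast
        ultimately show "R \<in> (\<Union>k\<in>I. B k)" by blast
      qed
      have Bk: "?P n (B k) \<le> 1 / real n ^ 2" if "k \<in> I" for k
      proof -
        have k: "0 < k" "real k \<le> \<alpha> * real n" "K * ln (real n) \<le> real k"
          using that unfolding I_def by auto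
        have "\<alpha> * real n < 1 * real n" using assms n by (intro mult_strict_right_mono) auto
        then have "k < n" using k by simp
        then have "?P n (B k) \<le> real n * (1 + real k * (\<epsilon> / real n) * t) ^ n
             * (t powr (-(\<delta> * real k))) ^ 3 / (1 - t) ^ k
             * (1 - \<epsilon> / real n * (1 - t)) ^ (k * (n - k))"
          unfolding B_def using k t n assms
          by (intro expansion_failure_prob_le[OF G]) auto
        also have "\<dots> \<le> real n * exp (- c / 4 * real k)"
          using k t n assms tc
          by (intro failure_bound_exponential[where \<alpha> = \<alpha>]) (auto simp: c_def \<delta>_def)
        also have "\<dots> \<le> real n * exp (- real 3 * ln (real n))"
        proof -
          have "3 * ln (real n) \<le> c / 4 * real k"
            using k(3) c unfolding K_def by (simp add: field_simps)
          then show ?thesis using n by simp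
        qed
        also have "\<dots> = real n * inverse (real n ^ 3)"
          using n by (simp only: mult_minus_left exp_minus exp_of_nat_mult) simp
        also have "\<dots> = 1 / real n ^ 2"
          using n by (simp add: field_simps power2_eq_square power3_eq_cube)
        finally show ?thesis .
      qed
      have "?P n (- ?E n) = ?P n (- ?E n \<inter> set_pmf (gnp n (\<epsilon> / real n)))"
        by (simp add: measure_Int_set_pmf)
      also have "\<dots> \<le> ?P n (\<Union>k\<in>I. B k)"
        using sub by (intro measure_pmf.finite_measure_mono) auto
      also have "\<dots> \<le> (\<Sum>k\<in>I. ?P n (B k))"
        unfolding I_def by (intro measure_UNION_le) auto
      also have "\<dots> \<le> real (card I) * (1 / real n ^ 2)"
        using Bk by (intro sum_bounded_above) auto
      also have "\<dots> \<le> real n * (1 / real n ^ 2)"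
      proof -
        have "card I \<le> card {1..n}" unfolding I_def by (intro card_mono) auto
        then show ?thesis by (intro mult_right_mono) auto
      qed
      also have "\<dots> = 1 / real n" by (simp add: power2_eq_square)
      finally show ?case
        using measure_pmf.prob_compl[of "?E n" "gnp n (\<epsilon> / real n)"]
        by (simp add: Compl_eq_Diff_UNIV)
    qed
  qed simp
  then show ?thesis using \<delta> K by blast
qed

end
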